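(* Let $X$ be either $\mathbb R^n$ or a fixed cube $Q\subset\mathbb R^n$, $n\ge1$, and let $\varphi$ be such that $e^\varphi\in A_\infty(X)$. For $c,d\in\mathbb R$ with $c<d$, let $$\varphi_{c,d}=c\,\chi_{\{\varphi\le c\}}+\varphi\,\chi_{\{c<\varphi<d\}}+d\,\chi_{\{\varphi\ge d\}}.$$ Then for any cube $J\subset X$, $$\big\langle e^{\varphi_{c,d}-\langle\varphi_{c,d}\rangle_J}\big\rangle_J\le\big\langle e^{\varphi-\langle\varphi\rangle_J}\big\rangle_J$$ and, consequently, $$\big[e^{\varphi_{c,d}}\big]_{A_\infty(X)}\le\big[e^{\varphi}\big]_{A_\infty(X)}.$$
   Context: For a cube $J\subset\mathbb R^n$, $\langle\varphi\rangle_J=\frac1{|J|}\int_J\varphi$. An a.e. positive function $w$ is in $A_\infty(X)$ if $w$ and $\log w$ are locally integrable and $[w]_{A_\infty(X)}:=\sup_{J\subset X}\langle w\rangle_Je^{-\langle\log w\rangle_J}<\infty$, the supremum being over all cubes $J\subset X$. $\chi_S$ denotes the characteristic function of $S$. *)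

theory Defs
  imports "HOL-Analysis.Analysis"
begin

text \<open>Cubes are closed, nondegenerate, and have sides parallel to the coordinate axes.\<close>

definition is_cube :: "(real ^ 'n) set \<Rightarrow> bool" where
  "is_cube J \<longleftrightarrow> (\<exists>a l. l > 0 \<and> J = cbox a (\<chi> i. a $ i + l))"

definition avg :: "(real ^ 'n \<Rightarrow> real) \<Rightarrow> (real ^ 'n) set \<Rightarrow> real" where
  "avg f J = (LINT x:J|lebesgue. f x) / measure lebesgue J"

text \<open>For a compact \<open>X\<close> (such as a closed cube) this is integrability on \<open>X\<close>.\<close>

definition locally_integrable_on :: "(real ^ 'n \<Rightarrow> real) \<Rightarrow> (real ^ 'n) set \<Rightarrow> bool" where
  "locally_integrable_on f X \<longleftrightarrow> (\<forall>K. compact K \<and> K \<subseteq> X \<longrightarrow> set_integrable lebesgue K f)"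

text \<open>The supremum is taken in \<^typ>\<open>ereal\<close>, so that it may be infinite.\<close>

definition Ainf_char :: "(real ^ 'n) set \<Rightarrow> (real ^ 'n \<Rightarrow> real) \<Rightarrow> ereal" where
  "Ainf_char X w =
     (SUP J \<in> {J. is_cube J \<and> J \<subseteq> X}. ereal (avg w J * exp (- avg (\<lambda>x. ln (w x)) J)))"

definition Ainf :: "(real ^ 'n) set \<Rightarrow> (real ^ 'n \<Rightarrow> real) set" where
  "Ainf X = {w. (AE x in lebesgue. x \<in> X \<longrightarrow> w x > 0)
                \<and> locally_integrable_on w X
                \<and> locally_integrable_on (\<lambda>x. ln (w x)) X
                \<and> Ainf_char X w < \<infinity>}"

definition trunc :: "real \<Rightarrow> real \<Rightarrow> (real ^ 'n \<Rightarrow> real) \<Rightarrow> real ^ 'n \<Rightarrow> real" where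
  "trunc c d \<phi> x = c * indicator {y. \<phi> y \<le> c} x
                   + \<phi> x * indicator {y. c < \<phi> y \<and> \<phi> y < d} x
                   + d * indicator {y. \<phi> y \<ge> d} x"

end

theory Submission
  imports Defs
begin

text \<open>
  Write \<open>\<psi>\<close> for the truncation, \<open>E\<close> for the average over \<open>J\<close>, \<open>M = E e\<^sup>\<psi>\<close> and \<open>t = E (\<phi> - \<psi>)\<close>.
  Since \<open>M\<close> lies between \<open>e\<^sup>c\<close> and \<open>e\<^sup>d\<close>, the functions \<open>\<phi> - \<psi>\<close> and \<open>e\<^sup>\<psi> - M\<close> never have opposite
  signs. Together with the tangent line inequality for \<open>exp\<close> at \<open>t\<close> this gives pointwise
  \<open>e\<^sup>\<phi> \<ge> e\<^sup>t (e\<^sup>\<psi> (1 - t) + M (\<phi> - \<psi>))\<close>, and averaging yields \<open>E e\<^sup>\<phi> \<ge> e\<^sup>t M\<close>, which is the claim.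
\<close>

lemma exp_clamp_bound:
  fixes c d M t y :: real
  defines "z \<equiv> max c (min d y)"
  assumes "c \<le> d" and "exp c \<le> M" and "M \<le> exp d"
  shows "exp t * (exp z * (1 - t) + M * (y - z)) \<le> exp y"
proof -
  have "(y - z) * (exp z - M) \<ge> 0"
    using assms by (auto simp: z_def max_def min_def zero_le_mult_iff)
  then have "exp t * (exp z * (1 - t) + M * (y - z)) \<le> exp t * (exp z * (1 + (y - z - t)))"
    by (intro mult_left_mono) (simp_all add: algebra_simps)
  also have "\<dots> \<le> exp t * (exp z * exp (y - z - t))"
    by (intro mult_left_mono exp_ge_add_one_self) simp_all
  also have "\<dots> = exp y"
    by (simp flip: exp_add)
  finally show ?thesis .
qed

lemma (in finite_measure) mean_exp_clamp_le:
  fixes f :: "'a \<Rightarrow> real" and c d :: real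
  defines "g \<equiv> \<lambda>x. max c (min d (f x))" and "m \<equiv> measure M (space M)"
  assumes "c \<le> d" and "m > 0" and f: "integrable M f" and expf: "integrable M (\<lambda>x. exp (f x))"
  shows "(LINT x|M. exp (g x)) / m * exp (- ((LINT x|M. g x) / m))
       \<le> (LINT x|M. exp (f x)) / m * exp (- ((LINT x|M. f x) / m))"
proof -
  have [measurable]: "f \<in> borel_measurable M"
    using f by auto
  have g: "integrable M g"
    unfolding g_def
    by (intro integrable_const_bound[where B = "\<bar>c\<bar> + \<bar>d\<bar>"]) (auto simp: max_def min_def)
  have g_bounds: "c \<le> g x" "g x \<le> d" for x
    using \<open>c \<le> d\<close> by (auto simp: g_def)
  have expg: "integrable M (\<lambda>x. exp (g x))"
    by (intro integrable_const_bound[where B = "exp d"]) (use \<open>c \<le> d\<close> in \<open>auto simp: g_def\<close>)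
  define A where "A = (LINT x|M. exp (g x)) / m"
  define t where "t = (LINT x|M. f x) / m - (LINT x|M. g x) / m"
  have "(LINT x|M. exp c) \<le> (LINT x|M. exp (g x))"
    and "(LINT x|M. exp (g x)) \<le> (LINT x|M. exp d)"
    by (rule integral_mono; use expg in \<open>simp add: g_bounds\<close>)+
  then have A_bounds: "exp c \<le> A" "A \<le> exp d"
    using \<open>m > 0\<close> by (simp_all add: A_def m_def field_simps)
  have "(LINT x|M. exp t * (exp (g x) * (1 - t) + A * (f x - g x))) \<le> (LINT x|M. exp (f x))"
    using f g expf expg exp_clamp_bound[OF \<open>c \<le> d\<close> A_bounds]
    by (intro integral_mono) (auto simp: g_def)
  also have "(LINT x|M. exp t * (exp (g x) * (1 - t) + A * (f x - g x)))
      = exp t * ((LINT x|M. exp (g x)) * (1 - t) + A * ((LINT x|M. f x) - (LINT x|M. g x)))"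
    using f g expg by simp
  also have "\<dots> = exp t * (A * m)"
    using \<open>m > 0\<close> by (simp add: A_def t_def field_simps)
  finally have "exp t * A \<le> (LINT x|M. exp (f x)) / m"
    using \<open>m > 0\<close> by (simp add: field_simps)
  then have "exp t * A * exp (- ((LINT x|M. f x) / m))
      \<le> (LINT x|M. exp (f x)) / m * exp (- ((LINT x|M. f x) / m))"
    by (rule mult_right_mono) simp
  moreover have "exp t * A * exp (- ((LINT x|M. f x) / m)) = A * exp (- ((LINT x|M. g x) / m))"
    by (simp add: t_def mult.commute mult.left_commute flip: exp_add)
  ultimately show ?thesis
    by (simp only: A_def)
qed

lemma trunc_eq_clamp: "c < d \<Longrightarrow> trunc c d \<phi> = (\<lambda>x. max c (min d (\<phi> x)))"
  by (auto simp: trunc_def indicator_def max_def min_def)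

lemma is_cubeD:
  fixes J :: "(real ^ 'n) set"
  assumes "is_cube J"
  shows "compact J" "measure lebesgue J > 0"
proof -
  obtain a l where "l > 0" and J: "J = cbox a (\<chi> i. a $ i + l)"
    using assms by (auto simp: is_cube_def)
  then have "box a (\<chi> i. a $ i + l) \<noteq> {}"
    by (simp add: interval_ne_empty_cart)
  then show "compact J" "measure lebesgue J > 0"
    by (auto simp: J content_pos_lt_eq box_ne_empty)
qed

lemma avg_eq_lebesgue_on:
  assumes "J \<in> sets lebesgue"
  shows "avg f J = (LINT x|lebesgue_on J. f x) / measure lebesgue J"
  using assms by (simp add: avg_def set_lebesgue_integral_def integral_restrict_space)

lemma avg_exp_diff: "avg (\<lambda>x. exp (f x - k)) J = avg (\<lambda>x. exp (f x)) J * exp (- k)"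
  by (simp add: avg_def exp_diff exp_minus divide_inverse)

lemma avg_exp_trunc_le:
  fixes J :: "(real ^ 'n) set"
  assumes "is_cube J" and "c < d"
    and \<phi>: "set_integrable lebesgue J \<phi>" and exp\<phi>: "set_integrable lebesgue J (\<lambda>x. exp (\<phi> x))"
  shows "avg (\<lambda>x. exp (trunc c d \<phi> x)) J * exp (- avg (trunc c d \<phi>) J)
       \<le> avg (\<lambda>x. exp (\<phi> x)) J * exp (- avg \<phi> J)"
proof -
  have J: "J \<in> lmeasurable"
    using is_cubeD(1)[OF \<open>is_cube J\<close>] by (rule lmeasurable_compact)
  then have [simp]: "J \<in> sets lebesgue" by auto
  interpret finite_measure "lebesgue_on J"
    using J by (rule finite_measure_lebesgue_on)
  have m: "measure (lebesgue_on J) (space (lebesgue_on J)) = measure lebesgue J"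
    by (simp add: measure_restrict_space)
  show ?thesis
    using mean_exp_clamp_le[of c d \<phi>] assms is_cubeD(2)[OF \<open>is_cube J\<close>]
    unfolding m trunc_eq_clamp[OF \<open>c < d\<close>]
    by (simp add: avg_eq_lebesgue_on set_integrable_def integrable_restrict_space)
qed

theorem lemma4p2:
  fixes X :: "(real ^ 'n) set" and \<phi> :: "real ^ 'n \<Rightarrow> real" and c d :: real
  assumes "X = UNIV \<or> is_cube X"
    and "(\<lambda>x. exp (\<phi> x)) \<in> Ainf X"
    and "c < d"
  shows "(\<forall>J. is_cube J \<and> J \<subseteq> X \<longrightarrow>
            avg (\<lambda>x. exp (trunc c d \<phi> x - avg (trunc c d \<phi>) J)) J
            \<le> avg (\<lambda>x. exp (\<phi> x - avg \<phi> J)) J)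
         \<and> Ainf_char X (\<lambda>x. exp (trunc c d \<phi> x)) \<le> Ainf_char X (\<lambda>x. exp (\<phi> x))"
proof -
  have "avg (\<lambda>x. exp (trunc c d \<phi> x)) J * exp (- avg (trunc c d \<phi>) J)
      \<le> avg (\<lambda>x. exp (\<phi> x)) J * exp (- avg \<phi> J)" if "is_cube J" "J \<subseteq> X" for J
    using assms(2) that is_cubeD(1)[OF that(1)]
    by (intro avg_exp_trunc_le[OF that(1) \<open>c < d\<close>]) (auto simp: Ainf_def locally_integrable_on_def)
  then show ?thesis
    by (auto simp: avg_exp_diff Ainf_char_def intro!: SUP_subset_mono)
qed

end
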